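(* Let $(\Omega,\mathcal D,\mathbb E)$ be a sublinear expectation space over a measurable space $(\Omega,\mathcal F)$ and let the measurable map $\theta:\Omega\to\Omega$ be expectation preserving. Then the following statements are equivalent: (i) The map $\theta$ is ergodic; (ii) Whenever $\xi:\Omega\to\mathbb R$ (or $\mathbb C$) is measurable, bounded quasi-surely and $U_1\xi=\xi$, then $\xi$ is constant quasi-surely. If $\mathbb E$ is regular, then (i) and (ii) are equivalent to (iii) Whenever $\xi:\Omega\to\mathbb R$ (or $\mathbb C$) is measurable and $U_1\xi=\xi$ quasi-surely, then $\xi$ is constant quasi-surely.
   Context: $(\Omega,\mathcal F)$ is a measurable space and $\mathcal D$ is the linear space of all $\mathcal F$-measurable real-valued functions on $\Omega$. A sublinear expectation is a functional $\mathbb E:\mathcal D\to\mathbb R$ that is monotone ($X\ge Y\Rightarrow\mathbb E[X]\ge\mathbb E[Y]$), constant preserving ($\mathbb E[c]=c$ for $c\in\mathbb R$), sub-additive ($\mathbb E[X+Y]\le\mathbb E[X]+\mathbb E[Y]$) and positively homogeneous ($\mathbb E[\lambda X]=\lambda\mathbb E[X]$ for $\lambda\ge0$). The triple $(\Omega,\mathcal D,\mathbb E)$ is a sublinear expectation space. A measurable map $\theta:\Omega\to\Omega$ is expectation preserving if $\mathbb E[X\circ\theta]=\mathbb E[X]$ for all $X\in\mathcal D$. The transformation operator is $U_1\xi(\omega)=\xi(\theta\omega)$. An expectation preserving $\theta$ is ergodic if any $B\in\mathcal F$ with $\theta^{-1}B=B$ satisfies either $\mathbb E[I_B]=0$ or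 $\mathbb E[I_{B^c}]=0$. A statement holds quasi-surely if it holds for all $\omega\in\Omega\setminus A$ for some set $A$ with $\mathbb E[I_A]=0$. $\mathbb E$ is regular if for any $A_n\in\mathcal F$ with $A_n\downarrow\emptyset$ we have $\mathbb E[I_{A_n}]\downarrow0$. *)

theory Defs
  imports "HOL-Analysis.Analysis"
begin

text \<open>
  The measurable space \<open>(\<Omega>, \<F>)\<close> is \<open>(space M, sets M)\<close>; the measure carried by \<open>M\<close> plays no role.
  The space \<open>\<D>\<close> is \<open>borel_measurable M\<close>. As HOL functions are total, pointwise comparisons are
  restricted to \<open>space M\<close>; monotonicity then makes \<open>E X\<close> independent of the values of \<open>X\<close>
  outside \<open>space M\<close>.
\<close>

locale sublinear_expectation_space =
  fixes M :: "'a measure" and E :: "('a \<Rightarrow> real) \<Rightarrow> real"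
  assumes monotone: "\<lbrakk>X \<in> borel_measurable M; Y \<in> borel_measurable M; \<forall>\<omega>\<in>space M. X \<omega> \<ge> Y \<omega>\<rbrakk>
      \<Longrightarrow> E X \<ge> E Y"
    and const_preserving: "E (\<lambda>\<omega>. c) = c"
    and sub_additive: "\<lbrakk>X \<in> borel_measurable M; Y \<in> borel_measurable M\<rbrakk>
      \<Longrightarrow> E (\<lambda>\<omega>. X \<omega> + Y \<omega>) \<le> E X + E Y"
    and pos_homogeneous: "\<lbrakk>X \<in> borel_measurable M; l \<ge> 0\<rbrakk> \<Longrightarrow> E (\<lambda>\<omega>. l * X \<omega>) = l * E X"

definition U1 :: "('a \<Rightarrow> 'a) \<Rightarrow> ('a \<Rightarrow> 'b) \<Rightarrow> 'a \<Rightarrow> 'b" where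
  "U1 \<theta> \<xi> = (\<lambda>\<omega>. \<xi> (\<theta> \<omega>))"

definition expectation_preserving ::
  "'a measure \<Rightarrow> (('a \<Rightarrow> real) \<Rightarrow> real) \<Rightarrow> ('a \<Rightarrow> 'a) \<Rightarrow> bool" where
  "expectation_preserving M E \<theta> \<longleftrightarrow>
     \<theta> \<in> measurable M M \<and> (\<forall>X\<in>borel_measurable M. E (X \<circ> \<theta>) = E X)"

definition ergodic :: "'a measure \<Rightarrow> (('a \<Rightarrow> real) \<Rightarrow> real) \<Rightarrow> ('a \<Rightarrow> 'a) \<Rightarrow> bool" where
  "ergodic M E \<theta> \<longleftrightarrow> expectation_preserving M E \<theta> \<and>
     (\<forall>B\<in>sets M. \<theta> -` B \<inter> space M = B \<longrightarrow>
        E (indicator B) = 0 \<or> E (indicator (space M - B)) = 0)"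

text \<open>The exceptional set is measurable, since \<open>E\<close> is only meaningful on \<open>borel_measurable M\<close>.\<close>

definition quasi_surely ::
  "'a measure \<Rightarrow> (('a \<Rightarrow> real) \<Rightarrow> real) \<Rightarrow> ('a \<Rightarrow> bool) \<Rightarrow> bool" where
  "quasi_surely M E P \<longleftrightarrow> (\<exists>A\<in>sets M. E (indicator A) = 0 \<and> (\<forall>\<omega>\<in>space M - A. P \<omega>))"

definition bounded_qs ::
  "'a measure \<Rightarrow> (('a \<Rightarrow> real) \<Rightarrow> real) \<Rightarrow> ('a \<Rightarrow> 'b::real_normed_vector) \<Rightarrow> bool" where
  "bounded_qs M E \<xi> \<longleftrightarrow> (\<exists>K. quasi_surely M E (\<lambda>\<omega>. norm (\<xi> \<omega>) \<le> K))"

definition constant_qs ::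
  "'a measure \<Rightarrow> (('a \<Rightarrow> real) \<Rightarrow> real) \<Rightarrow> ('a \<Rightarrow> 'b) \<Rightarrow> bool" where
  "constant_qs M E \<xi> \<longleftrightarrow> (\<exists>c. quasi_surely M E (\<lambda>\<omega>. \<xi> \<omega> = c))"

definition regular_expectation :: "'a measure \<Rightarrow> (('a \<Rightarrow> real) \<Rightarrow> real) \<Rightarrow> bool" where
  "regular_expectation M E \<longleftrightarrow>
     (\<forall>A. range A \<subseteq> sets M \<longrightarrow> decseq A \<longrightarrow> (\<Inter>n. A n) = {} \<longrightarrow>
        decseq (\<lambda>n. E (indicator (A n))) \<and> (\<lambda>n::nat. E (indicator (A n))) \<longlonglongrightarrow> 0)"

end

theory Submission
  imports Defs
begin

text \<open>
  Since \<open>E\<close> is finite on \<^emph>\<open>all\<close> measurable functions, the null sets are closed under countable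
  unions: if the \<open>A n\<close> are null with union \<open>A\<close> and \<open>X \<omega>\<close> is the least \<open>n\<close> with \<open>\<omega> \<in> A n\<close>
  (and \<open>0\<close> off \<open>A\<close>), then \<open>X \<ge> n\<close> on \<open>A\<close> outside a null set, whence \<open>n * E I\<^sub>A \<le> E X\<close> for every
  \<open>n\<close>. Hence quasi-sure invariance of \<open>\<xi>\<close> holds simultaneously along all iterates of \<open>\<theta>\<close> off one null set, \<open>{\<xi> \<in> S}\<close>
  coincides up to a null set with the strictly invariant limsup set
  \<open>{\<xi> \<circ> \<theta>\<^sup>n \<in> S infinitely often}\<close>, and ergodicity decides \<open>{\<xi> \<in> S}\<close>. Letting \<open>S\<close> run through a
  countable base of the topology shows that \<open>\<xi>\<close> is constant quasi-surely. Conversely, apply (ii) or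
  (iii) to indicators of invariant sets.
\<close>

context sublinear_expectation_space
begin

section \<open>Null sets and their countable unions\<close>

definition null_set :: "'a set \<Rightarrow> bool" where
  "null_set A \<longleftrightarrow> A \<in> sets M \<and> E (indicator A) = 0"

lemma quasi_surely_iff_null:
  "quasi_surely M E P \<longleftrightarrow> (\<exists>A. null_set A \<and> (\<forall>\<omega>\<in>space M - A. P \<omega>))"
  by (auto simp: quasi_surely_def null_set_def)

lemma E_cong:
  assumes "X \<in> borel_measurable M" "Y \<in> borel_measurable M" "\<And>\<omega>. \<omega> \<in> space M \<Longrightarrow> X \<omega> = Y \<omega>"
  shows "E X = E Y"
  using monotone[of X Y] monotone[of Y X] assms by force

lemma E_indicator_nonneg:
  assumes "A \<in> sets M"
  shows "0 \<le> E (indicator A)"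
  using monotone[of "indicator A" "\<lambda>_. 0"] const_preserving[of 0] assms by simp

lemma null_set_empty: "null_set {}"
  using const_preserving[of 0] by (simp add: null_set_def indicator_def[abs_def])

lemma null_set_subset:
  assumes "null_set A" "B \<in> sets M" "B \<subseteq> A"
  shows "null_set B"
proof -
  have "E (indicator B) \<le> E (indicator A)"
    using assms by (intro monotone) (auto simp: null_set_def indicator_def)
  then show ?thesis
    using assms E_indicator_nonneg[of B] by (simp add: null_set_def)
qed

lemma null_set_Un:
  assumes "null_set A" "null_set B"
  shows "null_set (A \<union> B)"
proof -
  have AB: "A \<in> sets M" "B \<in> sets M"
    using assms by (auto simp: null_set_def)
  have "E (indicator (A \<union> B)) \<le> E (\<lambda>\<omega>. indicator A \<omega> + indicator B \<omega>)"
    using AB by (intro monotone) (auto simp: indicator_def)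
  also have "\<dots> \<le> E (indicator A) + E (indicator B)"
    using AB by (intro sub_additive) auto
  finally show ?thesis
    using assms AB E_indicator_nonneg[of "A \<union> B"] by (simp add: null_set_def)
qed

lemma null_set_UN:
  fixes A :: "nat \<Rightarrow> 'a set"
  assumes null: "\<And>n. null_set (A n)"
  shows "null_set (\<Union>n. A n)"
proof -
  define U where "U = (\<Union>n. A n)"
  define X where "X = (\<lambda>\<omega>. if \<omega> \<in> U then real (LEAST n. \<omega> \<in> A n) else 0)"
  have A [measurable]: "A n \<in> sets M" for n
    using null by (simp add: null_set_def)
  have U [measurable]: "U \<in> sets M"
    unfolding U_def by auto
  have X [measurable]: "X \<in> borel_measurable M"
    unfolding X_def by measurable
  have initial: "null_set (\<Union>k<n. A k)" for n
  proof (induction n)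
    case 0
    show ?case by (simp add: null_set_empty)
  next
    case (Suc n)
    from null_set_Un[OF Suc.IH null[of n]] show ?case
      by (simp add: lessThan_Suc Un_commute)
  qed
  have bound: "real n * E (indicator U) \<le> E X" for n
  proof -
    let ?I = "\<Union>k<n. A k"
    have X_ge: "real n \<le> X \<omega>" if "\<omega> \<in> U" "\<omega> \<notin> ?I" for \<omega>
    proof -
      have "\<omega> \<in> A (LEAST n. \<omega> \<in> A n)"
        using that(1) unfolding U_def by (auto intro: LeastI)
      then have "\<not> (LEAST n. \<omega> \<in> A n) < n"
        using that(2) by blast
      then show ?thesis
        using that(1) by (simp add: X_def)
    qed
    have X_nonneg: "0 \<le> X \<omega>" for \<omega>
      by (simp add: X_def)
    have "real n * E (indicator U) = E (\<lambda>\<omega>. real n * indicator U \<omega>)"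
      by (subst pos_homogeneous) auto
    \<comment> \<open>On \<open>?I\<close>, where \<open>X\<close> may be below \<open>n\<close>,
      the second summand makes up the difference. It costs nothing in expectation, because
      \<open>?I\<close> is a finite union of null sets.\<close>
    also have "\<dots> \<le> E (\<lambda>\<omega>. X \<omega> + real n * indicator ?I \<omega>)"
      using X_ge X_nonneg by (intro monotone) (auto simp: indicator_def split: if_splits)
    also have "\<dots> \<le> E X + E (\<lambda>\<omega>. real n * indicator ?I \<omega>)"
      by (intro sub_additive) auto
    also have "E (\<lambda>\<omega>. real n * indicator ?I \<omega>) = 0"
      using initial[of n] by (subst pos_homogeneous) (auto simp: null_set_def)
    finally show ?thesis by simp
  qed
  have "E (indicator U) \<le> 0"
  proof (rule ccontr)
    assume "\<not> ?thesis"
    then obtain n where "E X < real n * E (indicator U)"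
      using reals_Archimedean3[of "E (indicator U)"] by auto
    with bound[of n] show False by simp
  qed
  then show ?thesis
    using E_indicator_nonneg[OF U] U unfolding null_set_def U_def by simp
qed

lemma null_set_UN_countable:
  assumes "countable I" "\<And>i. i \<in> I \<Longrightarrow> null_set (A i)"
  shows "null_set (\<Union>i\<in>I. A i)"
\<comment> \<open>The enumeration \<open>from_nat_into I\<close> has range \<open>I\<close> only for
  nonempty \<open>I\<close>.\<close>
proof (cases "I = {}")
  case True
  then show ?thesis by (simp add: null_set_empty)
next
  case False
  then have "(\<Union>i\<in>I. A i) = (\<Union>n. A (from_nat_into I n))"
    using range_from_nat_into[OF False assms(1)] by (metis UN_extend_simps(10))
  then show ?thesis
    using null_set_UN[of "\<lambda>n. A (from_nat_into I n)"] assms from_nat_into[OF False] by simp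
qed

section \<open>Invariant functions along orbits of \<open>\<theta>\<close>\<close>

lemma null_set_vimage:
  assumes \<theta>: "expectation_preserving M E \<theta>" and "null_set A"
  shows "null_set (\<theta> -` A \<inter> space M)"
proof -
  have [measurable]: "\<theta> \<in> measurable M M" "A \<in> sets M"
    using assms by (auto simp: expectation_preserving_def null_set_def)
  \<comment> \<open>The two functions may differ outside \<open>space M\<close>, since
    \<open>\<theta>\<close> can send such points into \<open>A\<close>; hence
    \<open>E_cong\<close>.\<close>
  have "E (indicator (\<theta> -` A \<inter> space M)) = E (indicator A \<circ> \<theta>)"
    by (intro E_cong) (auto simp: indicator_def comp_def)
  also have "\<dots> = 0"
    using assms by (simp add: expectation_preserving_def null_set_def)
  finally show ?thesis
    by (simp add: null_set_def measurable_sets)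
qed

lemma null_set_vimage_funpow:
  assumes \<theta>: "expectation_preserving M E \<theta>" and "null_set A"
  shows "null_set ((\<theta> ^^ n) -` A \<inter> space M)"
proof (induction n)
  case 0
  then show ?case
    using assms(2) by (auto intro: null_set_subset simp: null_set_def)
next
  case (Suc n)
  have "\<theta> \<in> measurable M M"
    using \<theta> by (simp add: expectation_preserving_def)
  then have "(\<theta> ^^ Suc n) -` A \<inter> space M = \<theta> -` ((\<theta> ^^ n) -` A \<inter> space M) \<inter> space M"
    by (auto simp: funpow_swap1 dest: measurable_space)
  then show ?case
    using null_set_vimage[OF \<theta> Suc.IH] by (simp only:)
qed

text \<open>Ergodicity decides only strictly invariant sets, whereas the preimage of
  \<open>S\<close> is invariant merely up to a null set. It is therefore replaced by a strictly
  invariant set that differs from it only inside a null set.\<close>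

lemma ergodic_vimage_dichotomy:
  assumes erg: "ergodic M E \<theta>" and \<xi> [measurable]: "\<xi> \<in> measurable M N" and S [measurable]: "S \<in> sets N"
    and inv: "quasi_surely M E (\<lambda>\<omega>. U1 \<theta> \<xi> \<omega> = \<xi> \<omega>)"
  shows "null_set (\<xi> -` S \<inter> space M) \<or> null_set (space M - \<xi> -` S)"
proof -
  have \<theta>: "expectation_preserving M E \<theta>"
    using erg by (simp add: ergodic_def)
  then have [measurable]: "\<theta> \<in> measurable M M"
    by (simp add: expectation_preserving_def)
  have \<theta>_space: "\<theta> \<omega> \<in> space M" if "\<omega> \<in> space M" for \<omega>
    using that by (rule measurable_space[rotated]) measurable
  have iter_space: "(\<theta> ^^ n) \<omega> \<in> space M" if "\<omega> \<in> space M" for n \<omega>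
    using that \<theta>_space by (induction n) auto
  have [measurable]: "\<theta> ^^ n \<in> measurable M M" for n
    by (induction n) auto
  obtain A where A: "null_set A" "\<And>\<omega>. \<omega> \<in> space M - A \<Longrightarrow> \<xi> (\<theta> \<omega>) = \<xi> \<omega>"
    using inv unfolding quasi_surely_iff_null U1_def by blast
  \<comment> \<open>Avoiding \<open>A\<close> once is not enough, as the orbit may enter
    \<open>A\<close> later. \<open>D\<close> collects the points whose orbit ever meets
    \<open>A\<close>.\<close>
  define D where "D = (\<Union>n. (\<theta> ^^ n) -` A \<inter> space M)"
  have D: "null_set D"
    unfolding D_def using null_set_vimage_funpow[OF \<theta> A(1)] by (rule null_set_UN)
  have orbit: "\<xi> ((\<theta> ^^ n) \<omega>) = \<xi> \<omega>" if "\<omega> \<in> space M - D" for n \<omega>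
  proof (induction n)
    case 0
    then show ?case by simp
  next
    case (Suc n)
    have "(\<theta> ^^ n) \<omega> \<in> space M - A"
      using that iter_space by (auto simp: D_def)
    from A(2)[OF this] Suc show ?case by simp
  qed
  \<comment> \<open>Occurring infinitely often does not depend on the first term of the orbit, so
    passing from \<open>\<omega>\<close> to \<open>\<theta> \<omega>\<close> changes nothing, even
    for points of \<open>D\<close>.\<close>
  define B where "B = {\<omega> \<in> space M. \<exists>\<^sub>F n in sequentially. \<xi> ((\<theta> ^^ n) \<omega>) \<in> S}"
  have B [measurable]: "B \<in> sets M"
    unfolding B_def frequently_sequentially by measurable
  have "\<theta> -` B \<inter> space M = B"
  proof -
    have "(\<exists>\<^sub>F n in sequentially. \<xi> ((\<theta> ^^ n) (\<theta> \<omega>)) \<in> S) \<longleftrightarrow>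
        (\<exists>\<^sub>F n in sequentially. \<xi> ((\<theta> ^^ n) \<omega>) \<in> S)" for \<omega>
      using eventually_sequentially_Suc[of "\<lambda>n. \<xi> ((\<theta> ^^ n) \<omega>) \<notin> S"]
      by (simp add: frequently_def funpow_swap1)
    then show ?thesis
      using \<theta>_space by (auto simp: B_def)
  qed
  with erg B have "null_set B \<or> null_set (space M - B)"
    unfolding ergodic_def null_set_def by auto
  \<comment> \<open>Off \<open>D\<close> the sequence is constant, so it lies in \<open>S\<close>
    infinitely often exactly when its initial value does.\<close>
  moreover have "\<omega> \<in> B \<longleftrightarrow> \<xi> \<omega> \<in> S" if "\<omega> \<in> space M - D" for \<omega>
    using that orbit[OF that] by (simp add: B_def)
  then have "\<xi> -` S \<inter> space M \<subseteq> B \<union> D" "space M - \<xi> -` S \<subseteq> (space M - B) \<union> D"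
    by auto
  moreover have "\<xi> -` S \<inter> space M \<in> sets M" "space M - \<xi> -` S \<in> sets M"
    using measurable_sets[OF \<xi> S] sets.compl_sets[OF measurable_sets[OF \<xi> S]]
    by (auto simp: Diff_Int)
  ultimately show ?thesis
    using null_set_Un[OF _ D] null_set_subset by metis
qed

text \<open>A countable base keeps the union of the discarded sets null, and T0 separation lets its
  members tell values apart. Real and complex functions are covered alike.\<close>

lemma ergodic_imp_constant_qs:
  fixes \<xi> :: "'a \<Rightarrow> 'b::{second_countable_topology, t0_space}"
  assumes erg: "ergodic M E \<theta>" and \<xi>: "\<xi> \<in> borel_measurable M"
    and inv: "quasi_surely M E (\<lambda>\<omega>. U1 \<theta> \<xi> \<omega> = \<xi> \<omega>)"
  shows "constant_qs M E \<xi>"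
proof -
  obtain \<B> :: "'b set set" where \<B>: "countable \<B>" "topological_basis \<B>"
    using ex_countable_basis by blast
  \<comment> \<open>\<open>N b\<close> is a null side of the dichotomy for \<open>b\<close>. Once it
    is discarded, the values of \<open>\<xi>\<close> at the remaining points are all in
    \<open>b\<close> or all outside it.\<close>
  define N where
    "N b = (if null_set (\<xi> -` b \<inter> space M) then \<xi> -` b \<inter> space M else space M - \<xi> -` b)" for b
  have "null_set (N b)" if "b \<in> \<B>" for b
    using ergodic_vimage_dichotomy[OF erg \<xi> _ inv, of b] topological_basis_open[OF \<B>(2) that]
    by (auto simp: N_def)
  then have null: "null_set (\<Union>b\<in>\<B>. N b)"
    by (rule null_set_UN_countable[OF \<B>(1)])
  have eq: "\<xi> \<omega> = \<xi> \<omega>'"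
    if "\<omega> \<in> space M - (\<Union>b\<in>\<B>. N b)" "\<omega>' \<in> space M - (\<Union>b\<in>\<B>. N b)" for \<omega> \<omega>'
  proof (rule ccontr)
    have base: "\<xi> \<omega> \<in> b \<longleftrightarrow> \<xi> \<omega>' \<in> b" if "b \<in> \<B>" for b
      using that \<open>\<omega> \<in> _\<close> \<open>\<omega>' \<in> _\<close> by (auto simp: N_def split: if_splits)
    assume "\<xi> \<omega> \<noteq> \<xi> \<omega>'"
    from iffD1[OF separation_t0 this] obtain V
      where V: "open V" "\<xi> \<omega> \<in> V \<longleftrightarrow> \<xi> \<omega>' \<notin> V"
      by blast
    \<comment> \<open>A base set inside \<open>V\<close> around whichever value lies in
      \<open>V\<close> misses the other value, against \<open>base\<close>.\<close>
    have "x \<in> V \<longrightarrow> (\<exists>b\<in>\<B>. x \<in> b \<and> b \<subseteq> V)" for x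
      using topological_basisE[OF \<B>(2) V(1), of x] by blast
    from this[of "\<xi> \<omega>"] this[of "\<xi> \<omega>'"] V(2) base show False
      by blast
  qed
  then have "\<exists>c. \<forall>\<omega>\<in>space M - (\<Union>b\<in>\<B>. N b). \<xi> \<omega> = c"
    by blast
  with null show ?thesis
    unfolding constant_qs_def quasi_surely_iff_null by blast
qed

section \<open>From constancy of invariant functions back to ergodicity\<close>

lemma quasi_surelyI:
  "\<forall>\<omega>\<in>space M. P \<omega> \<Longrightarrow> quasi_surely M E P"
  unfolding quasi_surely_iff_null using null_set_empty by blast

text \<open>The indicator of an invariant set is both bounded and strictly invariant, so constancy
  is demanded only for such functions; this serves both converse directions. The sort of
  \<open>'b\<close> supplies distinct values 0 and 1.\<close>

lemma ergodicI_bounded_invariant: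
  fixes \<theta> :: "'a \<Rightarrow> 'a"
  assumes \<theta>: "expectation_preserving M E \<theta>"
    and const: "\<And>\<xi> :: 'a \<Rightarrow> 'b::real_normed_algebra_1. \<lbrakk>\<xi> \<in> borel_measurable M; bounded_qs M E \<xi>;
      \<forall>\<omega>\<in>space M. U1 \<theta> \<xi> \<omega> = \<xi> \<omega>\<rbrakk> \<Longrightarrow> constant_qs M E \<xi>"
  shows "ergodic M E \<theta>"
proof -
  have "null_set B \<or> null_set (space M - B)" if B: "B \<in> sets M" "\<theta> -` B \<inter> space M = B" for B
  proof -
    define \<xi> :: "'a \<Rightarrow> 'b" where "\<xi> = (\<lambda>\<omega>. if \<omega> \<in> B then 1 else 0)"
    have "bounded_qs M E \<xi>"
      unfolding bounded_qs_def \<xi>_def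
      by (intro exI[of _ 1] quasi_surelyI) auto
    moreover have "\<forall>\<omega>\<in>space M. U1 \<theta> \<xi> \<omega> = \<xi> \<omega>"
      using B(2) by (auto simp: U1_def \<xi>_def)
    moreover have "\<xi> \<in> borel_measurable M"
      unfolding \<xi>_def using B(1) by measurable
    ultimately have "constant_qs M E \<xi>"
      using const by blast
    then obtain c A where A: "null_set A" "\<And>\<omega>. \<omega> \<in> space M - A \<Longrightarrow> \<xi> \<omega> = c"
      unfolding constant_qs_def quasi_surely_iff_null by blast
    show ?thesis
    \<comment> \<open>Comparing \<open>c\<close> with 1 suffices: off \<open>A\<close>, a point of
      \<open>B\<close> forces \<open>c = 1\<close> and any other point forces
      \<open>c = 0\<close>.\<close>
    proof (cases "c = 1")
      case True
      then have "space M - B \<subseteq> A"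
        using A(2) by (force simp: \<xi>_def)
      then show ?thesis
        using null_set_subset[OF A(1)] B(1) by blast
    next
      case False
      then have "B \<subseteq> A"
        using A(2) sets.sets_into_space[OF B(1)] by (force simp: \<xi>_def)
      then show ?thesis
        using null_set_subset[OF A(1)] B(1) by blast
    qed
  qed
  with \<theta> show ?thesis
    by (auto simp: ergodic_def null_set_def)
qed

section \<open>The equivalences for a general value type\<close>

lemma ergodic_iff_bounded_invariant:
  assumes "expectation_preserving M E \<theta>"
  shows "ergodic M E \<theta> \<longleftrightarrow>
    (\<forall>\<xi> :: 'a \<Rightarrow> 'b::{real_normed_algebra_1, second_countable_topology}.
      \<xi> \<in> borel_measurable M \<and> bounded_qs M E \<xi> \<and>
      (\<forall>\<omega>\<in>space M. U1 \<theta> \<xi> \<omega> = \<xi> \<omega>) \<longrightarrow> constant_qs M E \<xi>)"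
  (is "_ \<longleftrightarrow> ?R")
proof
  assume "ergodic M E \<theta>"
  then show ?R
    by (auto intro: ergodic_imp_constant_qs quasi_surelyI)
next
  assume ?R
  then show "ergodic M E \<theta>"
    \<comment> \<open>The value type is fixed by hand, since the goal does not mention it.\<close>
    by (intro ergodicI_bounded_invariant[where ?'b = 'b] assms) auto
qed

lemma ergodic_iff_qs_invariant:
  assumes "expectation_preserving M E \<theta>"
  shows "ergodic M E \<theta> \<longleftrightarrow>
    (\<forall>\<xi> :: 'a \<Rightarrow> 'b::{real_normed_algebra_1, second_countable_topology}.
      \<xi> \<in> borel_measurable M \<and> quasi_surely M E (\<lambda>\<omega>. U1 \<theta> \<xi> \<omega> = \<xi> \<omega>) \<longrightarrow> constant_qs M E \<xi>)"
  (is "_ \<longleftrightarrow> ?R")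
proof
  assume "ergodic M E \<theta>"
  then show ?R
    by (auto intro: ergodic_imp_constant_qs)
next
  assume ?R
  then show "ergodic M E \<theta>"
    by (intro ergodicI_bounded_invariant[where ?'b = 'b] assms) (auto intro: quasi_surelyI)
qed

end

theorem theorem2p6:
  fixes M :: "'a measure" and E :: "('a \<Rightarrow> real) \<Rightarrow> real" and \<theta> :: "'a \<Rightarrow> 'a"
  assumes "sublinear_expectation_space M E"
    and "expectation_preserving M E \<theta>"
  shows
    "(ergodic M E \<theta> \<longleftrightarrow>
       (\<forall>\<xi> :: 'a \<Rightarrow> real. \<xi> \<in> borel_measurable M \<and> bounded_qs M E \<xi> \<and>
          (\<forall>\<omega>\<in>space M. U1 \<theta> \<xi> \<omega> = \<xi> \<omega>) \<longrightarrow> constant_qs M E \<xi>)) \<and>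
     (ergodic M E \<theta> \<longleftrightarrow>
       (\<forall>\<xi> :: 'a \<Rightarrow> complex. \<xi> \<in> borel_measurable M \<and> bounded_qs M E \<xi> \<and>
          (\<forall>\<omega>\<in>space M. U1 \<theta> \<xi> \<omega> = \<xi> \<omega>) \<longrightarrow> constant_qs M E \<xi>)) \<and>
     (regular_expectation M E \<longrightarrow>
       (ergodic M E \<theta> \<longleftrightarrow>
         (\<forall>\<xi> :: 'a \<Rightarrow> real. \<xi> \<in> borel_measurable M \<and>
            quasi_surely M E (\<lambda>\<omega>. U1 \<theta> \<xi> \<omega> = \<xi> \<omega>) \<longrightarrow> constant_qs M E \<xi>)) \<and>
       (ergodic M E \<theta> \<longleftrightarrow>
         (\<forall>\<xi> :: 'a \<Rightarrow> complex. \<xi> \<in> borel_measurable M \<and>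
            quasi_surely M E (\<lambda>\<omega>. U1 \<theta> \<xi> \<omega> = \<xi> \<omega>) \<longrightarrow> constant_qs M E \<xi>)))"
proof -
  interpret sublinear_expectation_space M E by fact
  show ?thesis
    by (intro conjI impI ergodic_iff_bounded_invariant ergodic_iff_qs_invariant assms(2))
qed

end
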